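(* Let $q\ge 2$ be an integer and $\alpha\in[0,1)$. On the infinite $(q+1)$-regular tree $\mathbb{T}_{q+1}$, consider the simple random walk with laziness $\alpha$, and let $g(\ell,n)$ be the probability that the walk started at a vertex $u$ is at a given vertex $v$ with $\operatorname{dist}(u,v)=\ell$ after $n$ steps. Let $G(x,y)=\sum_{\ell,n\ge0}g(\ell,n)x^\ell y^n$ and $\gamma(y)=\sum_{n\ge 0}g(0,n)y^n$. Then, as formal power series, \[ \gamma(y) = q \left( \left( \tfrac{q-1}{2} \right) (1-\alpha y) + \sqrt{\Delta} \right)^{-1}, \] \[ G(x,y) = \frac{\left( \frac{q+1}{2} \right) (1-\alpha y) + \sqrt{\Delta}}{\left( \frac{q+1}{2} \right) (1-\alpha y) - (1-\alpha)xy + \sqrt{\Delta}} \cdot q \left( \left( \tfrac{q-1}{2} \right) (1-\alpha y) + \sqrt{\Delta} \right)^{-1}, \] where $\Delta = \left( \frac{q+1}{2} \right)^2 (1 - \alpha y)^2 - q(1-\alpha)^2 y^2$.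
   Context: The simple random walk with laziness $\alpha$: $p_0=u$, and at each step $p_{i+1}=p_i$ with probability $\alpha$ and $p_{i+1}=w$ with probability $\frac{1-\alpha}{q+1}$ for each neighbor $w$ of $p_i$. Here $\sqrt{\Delta}$ denotes the formal power series square root of $\Delta$ with constant term $\frac{q+1}{2}$. *)

theory Defs
  imports
    "HOL-Probability.Probability"
    "HOL-Computational_Algebra.Formal_Power_Series"
begin

text \<open>A simple graph is a symmetric irreflexive adjacency relation; the vertices are all
  elements of the type.\<close>

definition simple_graph :: "('v \<Rightarrow> 'v \<Rightarrow> bool) \<Rightarrow> bool" where
  "simple_graph adj \<longleftrightarrow> symp adj \<and> irreflp adj"

definition graph_cycle :: "('v \<Rightarrow> 'v \<Rightarrow> bool) \<Rightarrow> 'v list \<Rightarrow> bool" where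
  "graph_cycle adj c \<longleftrightarrow>
     length c \<ge> 3 \<and> distinct c \<and> successively adj c \<and> adj (last c) (hd c)"

definition tree :: "('v \<Rightarrow> 'v \<Rightarrow> bool) \<Rightarrow> bool" where
  "tree adj \<longleftrightarrow> simple_graph adj \<and> (\<forall>u v. adj\<^sup>*\<^sup>* u v) \<and> (\<nexists>c. graph_cycle adj c)"

definition neighbors :: "('v \<Rightarrow> 'v \<Rightarrow> bool) \<Rightarrow> 'v \<Rightarrow> 'v set" where
  "neighbors adj v = {w. adj v w}"

definition regular_tree :: "('v \<Rightarrow> 'v \<Rightarrow> bool) \<Rightarrow> nat \<Rightarrow> bool" where
  "regular_tree adj d \<longleftrightarrow>
     tree adj \<and> (\<forall>v. finite (neighbors adj v) \<and> card (neighbors adj v) = d)"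

definition graph_dist :: "('v \<Rightarrow> 'v \<Rightarrow> bool) \<Rightarrow> 'v \<Rightarrow> 'v \<Rightarrow> nat" where
  "graph_dist adj u v = (LEAST n. (adj ^^ n) u v)"

definition lazy_step :: "('v \<Rightarrow> 'v \<Rightarrow> bool) \<Rightarrow> real \<Rightarrow> 'v \<Rightarrow> 'v pmf" where
  "lazy_step adj \<alpha> p =
     bind_pmf (bernoulli_pmf \<alpha>)
       (\<lambda>stay. if stay then return_pmf p else pmf_of_set (neighbors adj p))"

lemma pmf_lazy_step:
  assumes "regular_tree adj (q + 1)" "0 \<le> \<alpha>" "\<alpha> \<le> 1"
  shows "pmf (lazy_step adj \<alpha> p) w =
    (if w = p then \<alpha> else if adj p w then (1 - \<alpha>) / (real q + 1) else 0)"
proof -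
  have fin: "finite (neighbors adj p)" and card: "card (neighbors adj p) = q + 1"
    and irr: "\<not> adj p p"
    using assms(1) by (auto simp: regular_tree_def tree_def simple_graph_def irreflp_def)
  have ne: "neighbors adj p \<noteq> {}" using card by auto
  show ?thesis
    using assms(2,3) fin card irr ne
    by (auto simp: lazy_step_def pmf_bind pmf_of_set neighbors_def indicator_def)
qed

text \<open>The law of the position after \<open>n\<close> steps of the walk started at \<open>u\<close>.\<close>

primrec lazy_walk :: "('v \<Rightarrow> 'v \<Rightarrow> bool) \<Rightarrow> real \<Rightarrow> 'v \<Rightarrow> nat \<Rightarrow> 'v pmf" where
  "lazy_walk adj \<alpha> u 0 = return_pmf u"
| "lazy_walk adj \<alpha> u (Suc n) = bind_pmf (lazy_walk adj \<alpha> u n) (lazy_step adj \<alpha>)"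

text \<open>The number \<open>g(\<ell>,n)\<close>: the common value of the \<open>n\<close>-step transition probabilities between
  vertices at distance \<open>\<ell>\<close>.\<close>

definition walk_prob :: "('v \<Rightarrow> 'v \<Rightarrow> bool) \<Rightarrow> real \<Rightarrow> nat \<Rightarrow> nat \<Rightarrow> real" where
  "walk_prob adj \<alpha> l n =
     (THE r. \<forall>u v. graph_dist adj u v = l \<longrightarrow> pmf (lazy_walk adj \<alpha> u n) v = r)"

text \<open>Bivariate series in \<open>x\<close> and \<open>y\<close> are power series in \<open>x\<close> whose coefficients are power
  series in \<open>y\<close>. Thus \<open>x\<close> is \<open>fps_X\<close> at the outer level, and a series \<open>f(y)\<close> is embedded
  as \<open>fps_const f\<close>.\<close>

definition walk_gf :: "('v \<Rightarrow> 'v \<Rightarrow> bool) \<Rightarrow> real \<Rightarrow> real fps fps" where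
  "walk_gf adj \<alpha> = Abs_fps (\<lambda>l. Abs_fps (\<lambda>n. walk_prob adj \<alpha> l n))"

definition return_gf :: "('v \<Rightarrow> 'v \<Rightarrow> bool) \<Rightarrow> real \<Rightarrow> real fps" where
  "return_gf adj \<alpha> = Abs_fps (\<lambda>n. walk_prob adj \<alpha> 0 n)"

definition Delta :: "nat \<Rightarrow> real \<Rightarrow> real fps" where
  "Delta q \<alpha> =
     fps_const (((real q + 1) / 2)\<^sup>2) * (1 - fps_const \<alpha> * fps_X)\<^sup>2
     - fps_const (real q * (1 - \<alpha>)\<^sup>2) * fps_X\<^sup>2"

definition sqrt_Delta :: "nat \<Rightarrow> real \<Rightarrow> real fps" where
  "sqrt_Delta q \<alpha> = (THE S. S\<^sup>2 = Delta q \<alpha> \<and> fps_nth S 0 = (real q + 1) / 2)"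

lemma sqrt_Delta:
  shows "(sqrt_Delta q \<alpha>)\<^sup>2 = Delta q \<alpha>"
    and "fps_nth (sqrt_Delta q \<alpha>) 0 = (real q + 1) / 2"
proof -
  let ?P = "\<lambda>S. S\<^sup>2 = Delta q \<alpha> \<and> fps_nth S 0 = (real q + 1) / 2"
  let ?R = "fps_radical (\<lambda>_ _. (real q + 1) / 2) 2 (Delta q \<alpha>)"
  have D0: "fps_nth (Delta q \<alpha>) 0 = ((real q + 1) / 2)\<^sup>2"
    by (simp add: Delta_def fps_nth_power_0)
  have "?P ?R"
    using power_radical[of "Delta q \<alpha>" "\<lambda>_ _. (real q + 1) / 2" 1] D0
    by (simp add: numeral_2_eq_2)
  moreover have "S = T" if "?P S" "?P T" for S T
  proof -
    have "(S - T) * (S + T) = 0"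
      using that by (simp add: algebra_simps power2_eq_square)
    moreover have "fps_nth (S + T) 0 \<noteq> 0"
      using that by simp
    then have "S + T \<noteq> 0" by (metis fps_zero_nth)
    ultimately show ?thesis by simp
  qed
  ultimately have "\<exists>!S. ?P S" by blast
  then have "?P (sqrt_Delta q \<alpha>)"
    unfolding sqrt_Delta_def by (rule theI')
  then show "(sqrt_Delta q \<alpha>)\<^sup>2 = Delta q \<alpha>"
    and "fps_nth (sqrt_Delta q \<alpha>) 0 = (real q + 1) / 2" by simp_all
qed

text \<open>\<open>c (1 - \<alpha> y)\<close> as a power series in \<open>y\<close>.\<close>

definition lin :: "real \<Rightarrow> real \<Rightarrow> real fps" where
  "lin c \<alpha> = fps_const c * (1 - fps_const \<alpha> * fps_X)"

text \<open>The two series inverted in the closed forms are units, so \<open>inverse\<close> and \<open>/\<close> are the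
  true inverse and quotient in the respective rings of power series.\<close>

lemma return_denominator_unit:
  assumes "q \<ge> 1"
  shows "(lin ((real q - 1) / 2) \<alpha> + sqrt_Delta q \<alpha>) *
    inverse (lin ((real q - 1) / 2) \<alpha> + sqrt_Delta q \<alpha>) = 1"
  using assms by (intro inverse_mult_eq_1') (simp add: lin_def sqrt_Delta field_simps)

lemma walk_denominator_unit:
  fixes q :: nat and \<alpha> :: real
  defines "D \<equiv> fps_const (lin ((real q + 1) / 2) \<alpha>)
      - fps_const (fps_const (1 - \<alpha>) * fps_X) * fps_X + fps_const (sqrt_Delta q \<alpha>)"
  shows "D * (F / D) = F"
proof -
  have D0: "fps_nth D 0 = lin ((real q + 1) / 2) \<alpha> + sqrt_Delta q \<alpha>"
    by (simp add: D_def)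
  have nz: "fps_nth (fps_nth D 0) 0 \<noteq> 0"
    by (simp add: D0 lin_def sqrt_Delta field_simps)
  then have "fps_nth D 0 \<noteq> 0" by auto
  then have sd: "subdegree D = 0" by (rule subdegree_eq_0)
  have "fps_nth D 0 * inverse (fps_nth D 0) = 1"
    using nz by (rule inverse_mult_eq_1')
  then have "D * inverse D = 1"
    unfolding fps_inverse_def by (rule fps_right_inverse)
  then show ?thesis
    using sd by (simp add: fps_divide_def mult.left_commute)
qed

end

theory Submission
  imports Defs
begin

text \<open>
  From a vertex \<open>v \<noteq> u\<close> of the tree exactly one neighbor is closer to \<open>u\<close> and the other \<open>q\<close> are
  farther away; all neighbors of \<open>u\<close> are at distance \<open>1\<close>. Hence, if power series \<open>K l\<close> in \<open>y\<close> satisfy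
  \<open>(1 - \<alpha>y) K 0 = 1 + (1 - \<alpha>) y K 1\<close> and
  \<open>(q + 1) (1 - \<alpha>y) K (l + 1) = (1 - \<alpha>) y (K l + q K (l + 2))\<close>, then comparison of coefficients and
  induction on the number \<open>n\<close> of steps identify the \<open>n\<close>-th coefficient of \<open>K l\<close> with the
  \<open>n\<close>-step transition probability at distance \<open>l\<close>. The geometric sequence \<open>K l = \<gamma> r\<^sup>l\<close> with
  \<open>r = (1 - \<alpha>) y / ((q + 1)/2 (1 - \<alpha>y) + \<surd>\<Delta>)\<close> is a solution, because \<open>r\<close> is the root divisible by
  \<open>y\<close> of \<open>(1 - \<alpha>) y (1 + q r\<^sup>2) = (q + 1) (1 - \<alpha>y) r\<close>.
\<close>

section \<open>Distances in trees\<close>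

lemma tree_relpowp_graph_dist:
  assumes "tree adj"
  shows "(adj ^^ graph_dist adj u v) u v"
proof -
  have "\<exists>n. (adj ^^ n) u v"
    using assms by (simp add: tree_def rtranclp_is_Sup_relpowp)
  then show ?thesis
    unfolding graph_dist_def by (rule LeastI_ex)
qed

lemma graph_dist_le: "(adj ^^ n) u v \<Longrightarrow> graph_dist adj u v \<le> n"
  unfolding graph_dist_def by (rule Least_le)

lemma graph_dist_self: "graph_dist adj u u = 0"
  using graph_dist_le[of 0 adj u u] by simp

lemma tree_graph_dist_eq_0_iff:
  assumes "tree adj"
  shows "graph_dist adj u v = 0 \<longleftrightarrow> u = v"
  using tree_relpowp_graph_dist[OF assms, of u v] graph_dist_self by fastforce

lemma tree_graph_dist_adj_le:
  assumes "tree adj" "adj v w"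
  shows "graph_dist adj u w \<le> Suc (graph_dist adj u v)"
  using tree_relpowp_graph_dist[OF assms(1), of u v] assms(2)
  by (intro graph_dist_le) auto

lemma tree_adj_sym: "tree adj \<Longrightarrow> adj v w \<Longrightarrow> adj w v"
  by (auto simp: tree_def simple_graph_def dest: sympD)

text \<open>The last vertex but one of a shortest walk works: it is reached in \<open>l\<close>
  steps, and fewer would bring \<open>v\<close> closer to \<open>u\<close>.\<close>

lemma tree_predecessor:
  assumes "tree adj" "graph_dist adj u v = Suc l"
  obtains w where "adj w v" "graph_dist adj u w = l"
proof -
  obtain w where w: "(adj ^^ l) u w" "adj w v"
    using tree_relpowp_graph_dist[OF assms(1), of u v] assms(2) by auto
  have "graph_dist adj u w = l"
    using graph_dist_le[OF w(1)] tree_graph_dist_adj_le[OF assms(1) w(2), of u] assms(2) by simp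
  with w that show ?thesis by blast
qed

text \<open>Extending both ends of such a path towards \<open>u\<close> gives a path of the same kind at the next
  smaller level or closes a cycle.\<close>

lemma tree_no_path_above_level:
  assumes tree: "tree adj"
  shows "\<lbrakk>length c \<ge> 2; distinct c; successively adj c;
    graph_dist adj u (hd c) = l; graph_dist adj u (last c) = l;
    \<forall>w\<in>set c. l \<le> graph_dist adj u w\<rbrakk> \<Longrightarrow> False"
proof (induction l arbitrary: c)
  case 0
  \<comment> \<open>Level 0 contains only \<open>u\<close>, but a distinct list with at least two
    entries has different ends.\<close>
  then have "hd c = last c"
    using tree_graph_dist_eq_0_iff[OF tree] by metis
  with 0 show False
    by (cases c) (auto split: if_splits)
next
  case (Suc l)
  have ne: "c \<noteq> []" using Suc.prems(1) by auto
  obtain a where a: "adj a (hd c)" "graph_dist adj u a = l"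
    using tree_predecessor[OF tree Suc.prems(4)] by blast
  obtain b where b: "adj b (last c)" "graph_dist adj u b = l"
    using tree_predecessor[OF tree Suc.prems(5)] by blast
  have nin: "a \<notin> set c" "b \<notin> set c"
    using Suc.prems(6) a(2) b(2) by fastforce+
  have b': "adj (last c) b" using tree_adj_sym[OF tree b(1)] .
  show False
  proof (cases "a = b")
    case True
    \<comment> \<open>\<open>c\<close> has at least two vertices, so \<open>a # c\<close> has the
      three that a cycle needs; \<open>a\<close> lies below the level of \<open>c\<close>, hence
      outside it.\<close>
    have "graph_cycle adj (a # c)"
      using Suc.prems(1-3) nin a(1) b' ne True
      by (auto simp: graph_cycle_def successively_Cons)
    with tree show False by (auto simp: tree_def)
  next
    case False
    show False
    proof (rule Suc.IH[of "a # c @ [b]"])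
      show "successively adj (a # c @ [b])"
        using Suc.prems(3) a(1) b' ne by (auto simp: successively_Cons successively_append_iff)
      show "\<forall>w\<in>set (a # c @ [b]). l \<le> graph_dist adj u w"
        using Suc.prems(6) a(2) b(2) by fastforce
    qed (use Suc.prems nin False a b in auto)
  qed
qed

text \<open>An edge within one level would be a two-vertex path of the excluded kind.\<close>

lemma tree_adj_graph_dist_neq:
  assumes "tree adj" "adj v w"
  shows "graph_dist adj u v \<noteq> graph_dist adj u w"
proof
  assume "graph_dist adj u v = graph_dist adj u w"
  moreover have "v \<noteq> w"
    using assms by (auto simp: tree_def simple_graph_def irreflp_def)
  ultimately show False
    using tree_no_path_above_level[OF assms(1), of "[v, w]" u "graph_dist adj u v"] assms(2) by auto
qed

text \<open>Two different predecessors would make \<open>[w, v, w']\<close> a path of the excluded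
  kind at level \<open>l\<close>.\<close>

lemma tree_predecessor_unique:
  assumes "tree adj" "graph_dist adj u v = Suc l"
    "adj v w" "graph_dist adj u w = l" "adj v w'" "graph_dist adj u w' = l"
  shows "w = w'"
proof (rule ccontr)
  assume "w \<noteq> w'"
  moreover have "w \<noteq> v" "v \<noteq> w'"
    using assms by auto
  ultimately show False
    using tree_no_path_above_level[OF assms(1), of "[w, v, w']" u l]
      tree_adj_sym[OF assms(1)] assms(2-) by auto
qed

text \<open>Along an edge the distance to \<open>u\<close> changes by at most 1 and never stays
  equal; it drops only towards the unique predecessor.\<close>

lemma tree_neighbor_dists:
  assumes "tree adj" "graph_dist adj u v = Suc l"
  obtains w where "w \<in> neighbors adj v" "graph_dist adj u w = l"
    "\<And>x. x \<in> neighbors adj v - {w} \<Longrightarrow> graph_dist adj u x = Suc (Suc l)"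
proof -
  obtain w where w: "adj w v" "graph_dist adj u w = l"
    using tree_predecessor[OF assms] by blast
  have vw: "adj v w" using tree_adj_sym[OF assms(1) w(1)] .
  have "graph_dist adj u x = Suc (Suc l)" if "adj v x" "x \<noteq> w" for x
    using tree_graph_dist_adj_le[OF assms(1) that(1), of u]
      tree_graph_dist_adj_le[OF assms(1) tree_adj_sym[OF assms(1) that(1)], of u]
      tree_adj_graph_dist_neq[OF assms(1) that(1), of u]
      tree_predecessor_unique[OF assms that(1) _ vw w(2)] that(2) assms(2)
    by linarith
  then show ?thesis
    using that[of w] vw w(2) by (auto simp: neighbors_def)
qed

lemma tree_neighbor_dist_self:
  assumes "tree adj" "x \<in> neighbors adj u"
  shows "graph_dist adj u x = Suc 0"
  using tree_graph_dist_adj_le[OF assms(1), of u x u] tree_adj_graph_dist_neq[OF assms(1), of u x u]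
    assms(2) by (auto simp: neighbors_def graph_dist_self)

text \<open>Of the \<open>d\<close> neighbors of a vertex other than \<open>u\<close> only one is
  closer to \<open>u\<close>, so at least one leads outward.\<close>

lemma regular_tree_dist_attained:
  assumes "regular_tree adj d" "d \<ge> 2"
  shows "\<exists>v. graph_dist adj u v = l"
proof (induction l)
  case 0
  show ?case by (rule exI[of _ u]) (rule graph_dist_self)
next
  case (Suc l)
  then obtain v where v: "graph_dist adj u v = l" by blast
  have tree: "tree adj" and fin: "finite (neighbors adj v)" and card: "card (neighbors adj v) = d"
    using assms(1) by (auto simp: regular_tree_def)
  show ?case
  proof (cases l)
    case 0
    with v have "u = v" using tree_graph_dist_eq_0_iff[OF tree] by simp
    moreover obtain x where "x \<in> neighbors adj v" using card assms(2) by fastforce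
    ultimately show ?thesis using tree_neighbor_dist_self[OF tree] 0 by blast
  next
    case (Suc k)
    obtain w where w: "w \<in> neighbors adj v"
      "\<And>x. x \<in> neighbors adj v - {w} \<Longrightarrow> graph_dist adj u x = Suc (Suc k)"
      using tree_neighbor_dists[OF tree] v Suc by metis
    have "card (neighbors adj v - {w}) \<noteq> 0"
      using w(1) fin card assms(2) by simp
    then have "neighbors adj v - {w} \<noteq> {}" by (metis card.empty)
    then obtain x where "x \<in> neighbors adj v - {w}" by blast
    with w(2) Suc show ?thesis by blast
  qed
qed

section \<open>Transition probabilities\<close>

text \<open>Condition on the position before the last step. Since adjacency is symmetric, this is
  \<open>v\<close> or a neighbor of \<open>v\<close>; regularity gives all neighbors the same
  weight.\<close>

lemma pmf_lazy_walk_Suc: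
  assumes "regular_tree adj (q + 1)" "0 \<le> \<alpha>" "\<alpha> \<le> 1"
  shows "pmf (lazy_walk adj \<alpha> u (Suc n)) v = \<alpha> * pmf (lazy_walk adj \<alpha> u n) v +
    (1 - \<alpha>) / (real q + 1) * (\<Sum>x\<in>neighbors adj v. pmf (lazy_walk adj \<alpha> u n) x)"
proof -
  have tree: "tree adj" and fin: "finite (neighbors adj v)"
    using assms(1) by (auto simp: regular_tree_def)
  have nin: "v \<notin> neighbors adj v"
    using tree by (auto simp: neighbors_def tree_def simple_graph_def irreflp_def)
  have nb: "adj x v \<longleftrightarrow> x \<in> neighbors adj v" for x
    using tree_adj_sym[OF tree] by (auto simp: neighbors_def)
  note step = pmf_lazy_step[OF assms]
  have "pmf (lazy_walk adj \<alpha> u (Suc n)) v =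
      (LINT x|measure_pmf (lazy_walk adj \<alpha> u n). pmf (lazy_step adj \<alpha> x) v)"
    by (simp add: pmf_bind)
  also have "\<dots> = (\<Sum>x\<in>insert v (neighbors adj v).
      pmf (lazy_walk adj \<alpha> u n) x *\<^sub>R pmf (lazy_step adj \<alpha> x) v)"
    using fin by (intro integral_measure_pmf) (auto simp: step nb split: if_splits)
  also have "\<dots> = \<alpha> * pmf (lazy_walk adj \<alpha> u n) v +
      (\<Sum>x\<in>neighbors adj v. pmf (lazy_walk adj \<alpha> u n) x *\<^sub>R pmf (lazy_step adj \<alpha> x) v)"
    using fin nin by (simp add: step)
  also have "(\<Sum>x\<in>neighbors adj v. pmf (lazy_walk adj \<alpha> u n) x *\<^sub>R pmf (lazy_step adj \<alpha> x) v) =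
      (\<Sum>x\<in>neighbors adj v. (1 - \<alpha>) / (real q + 1) * pmf (lazy_walk adj \<alpha> u n) x)"
    using nin by (intro sum.cong) (auto simp: step nb)
  finally show ?thesis by (simp add: sum_distrib_left)
qed

text \<open>The conclusion also shows that the transition probabilities depend on the distance only,
  without any appeal to automorphisms of the tree.\<close>

lemma pmf_lazy_walk_eq_fps_nth:
  fixes K :: "nat \<Rightarrow> real fps"
  assumes reg: "regular_tree adj (q + 1)" and \<alpha>: "0 \<le> \<alpha>" "\<alpha> \<le> 1"
    and K0: "(1 - fps_const \<alpha> * fps_X) * K 0 = 1 + fps_const (1 - \<alpha>) * fps_X * K 1"
    and KSuc: "\<And>l. fps_const (real q + 1) * (1 - fps_const \<alpha> * fps_X) * K (Suc l) =
      fps_const (1 - \<alpha>) * fps_X * (K l + fps_const (real q) * K (Suc (Suc l)))"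
  shows "pmf (lazy_walk adj \<alpha> u n) v = fps_nth (K (graph_dist adj u v)) n"
proof -
  have tree: "tree adj" and fin: "\<And>v. finite (neighbors adj v)"
    and card: "\<And>v. card (neighbors adj v) = q + 1"
    using reg by (auto simp: regular_tree_def)
  \<comment> \<open>With all terms in \<open>y\<close> collected behind a factor
    \<open>fps_X\<close>, coefficient \<open>n + 1\<close> on the left is read off from coefficients
    \<open>n\<close> on the right.\<close>
  have K0': "K 0 = 1 + fps_X * (fps_const \<alpha> * K 0 + fps_const (1 - \<alpha>) * K 1)"
    using K0 by (simp add: algebra_simps)
  have KS': "fps_const (real q + 1) * K (Suc l) =
      fps_X * (fps_const (real q + 1) * (fps_const \<alpha> * K (Suc l)) +
        fps_const (1 - \<alpha>) * (K l + fps_const (real q) * K (Suc (Suc l))))" for l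
    using KSuc[of l] by (simp only: ring_distribs ac_simps mult_1_right mult_1_left) algebra
  have c00: "fps_nth (K 0) 0 = 1"
    by (subst K0') simp
  have cS0: "fps_nth (K (Suc l)) 0 = 0" for l
  proof -
    have "(real q + 1) * fps_nth (K (Suc l)) 0 = 0"
      using arg_cong[OF KS'[of l], of "\<lambda>f. fps_nth f 0"]
      by (simp del: fps_const_add fps_const_sub)
    then show ?thesis by (simp add: add_nonneg_eq_0_iff)
  qed
  have c0S: "fps_nth (K 0) (Suc n) = \<alpha> * fps_nth (K 0) n + (1 - \<alpha>) * fps_nth (K 1) n" for n
    by (subst K0') (simp del: fps_const_sub)
  have cSS: "(real q + 1) * fps_nth (K (Suc l)) (Suc n) =
     (real q + 1) * (\<alpha> * fps_nth (K (Suc l)) n) +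
     (1 - \<alpha>) * (fps_nth (K l) n + real q * fps_nth (K (Suc (Suc l))) n)" for l n
    using arg_cong[OF KS'[of l], of "\<lambda>f. fps_nth f (Suc n)"]
    by (simp del: fps_const_add fps_const_sub)
  show ?thesis
  proof (induction n arbitrary: v)
    case 0
    show ?case
    proof (cases "graph_dist adj u v")
      case 0
      then show ?thesis using c00 tree_graph_dist_eq_0_iff[OF tree, of u v] by simp
    next
      case (Suc l)
      then have "u \<noteq> v" by (auto simp: graph_dist_self)
      with Suc show ?thesis using cS0 by simp
    qed
  next
    case (Suc n)
    let ?S = "\<Sum>x\<in>neighbors adj v. pmf (lazy_walk adj \<alpha> u n) x"
    have S: "?S = (\<Sum>x\<in>neighbors adj v. fps_nth (K (graph_dist adj u x)) n)"
      using Suc.IH by simp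
    have step: "pmf (lazy_walk adj \<alpha> u (Suc n)) v =
        \<alpha> * fps_nth (K (graph_dist adj u v)) n + (1 - \<alpha>) / (real q + 1) * ?S"
      using pmf_lazy_walk_Suc[OF reg \<alpha>] Suc.IH by metis
    show ?case
    proof (cases "graph_dist adj u v")
      case 0
      then have "u = v" using tree_graph_dist_eq_0_iff[OF tree] by simp
      then have "?S = (\<Sum>x\<in>neighbors adj v. fps_nth (K 1) n)"
        unfolding S using tree_neighbor_dist_self[OF tree] by (intro sum.cong) auto
      also have "\<dots> = (real q + 1) * fps_nth (K 1) n"
        using card by simp
      finally show ?thesis using 0 step c0S[of n] by simp
    next
      case (Suc l)
      obtain w where w: "w \<in> neighbors adj v" "graph_dist adj u w = l"
        "\<And>x. x \<in> neighbors adj v - {w} \<Longrightarrow> graph_dist adj u x = Suc (Suc l)"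
        using tree_neighbor_dists[OF tree Suc] by metis
      have "?S = fps_nth (K l) n + (\<Sum>x\<in>neighbors adj v - {w}. fps_nth (K (graph_dist adj u x)) n)"
        unfolding S by (subst sum.remove[OF fin w(1)]) (simp add: w(2))
      also have "(\<Sum>x\<in>neighbors adj v - {w}. fps_nth (K (graph_dist adj u x)) n) =
          (\<Sum>x\<in>neighbors adj v - {w}. fps_nth (K (Suc (Suc l))) n)"
        using w(3) by (intro sum.cong) auto
      also have "\<dots> = real q * fps_nth (K (Suc (Suc l))) n"
        using fin card w(1) by simp
      finally have "(real q + 1) * pmf (lazy_walk adj \<alpha> u (Suc n)) v =
          (real q + 1) * fps_nth (K (Suc l)) (Suc n)"
        unfolding step cSS Suc by (simp add: field_simps)
      then show ?thesis using Suc by (simp add: add_nonneg_eq_0_iff)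
    qed
  qed
qed

text \<open>The second assumption makes the described value unique: at a distance that never occurs,
  every real would satisfy the description vacuously.\<close>

lemma walk_prob_eqI:
  assumes "\<And>u v. pmf (lazy_walk adj \<alpha> u n) v = f (graph_dist adj u v)"
    and "\<exists>u v. graph_dist adj u v = l"
  shows "walk_prob adj \<alpha> l n = f l"
  unfolding walk_prob_def using assms by (intro the_equality) auto

section \<open>The closed forms\<close>

theorem theorem7p7:
  fixes adj :: "'v \<Rightarrow> 'v \<Rightarrow> bool" and q :: nat and \<alpha> :: real
  assumes "q \<ge> 2" and "0 \<le> \<alpha>" and "\<alpha> < 1"
    and "regular_tree adj (q + 1)"
  shows "(\<forall>u v n. pmf (lazy_walk adj \<alpha> u n) v = walk_prob adj \<alpha> (graph_dist adj u v) n) \<and>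
    return_gf adj \<alpha> =
      fps_const (real q) * inverse (lin ((real q - 1) / 2) \<alpha> + sqrt_Delta q \<alpha>) \<and>
    walk_gf adj \<alpha> =
      (fps_const (lin ((real q + 1) / 2) \<alpha>) + fps_const (sqrt_Delta q \<alpha>)) /
      (fps_const (lin ((real q + 1) / 2) \<alpha>)
         - fps_const (fps_const (1 - \<alpha>) * fps_X) * fps_X + fps_const (sqrt_Delta q \<alpha>)) *
      fps_const (fps_const (real q) * inverse (lin ((real q - 1) / 2) \<alpha> + sqrt_Delta q \<alpha>))"
proof -
  define L where "L = 1 - fps_const \<alpha> * (fps_X :: real fps)"
  define t where "t = fps_const (1 - \<alpha>) * (fps_X :: real fps)"
  define s where "s = sqrt_Delta q \<alpha>"
  define Q where "Q = fps_const (real q)"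
  define h where "h = fps_const (1 / 2 :: real)"
  define E where "E = lin ((real q - 1) / 2) \<alpha> + s"
  define D where "D = lin ((real q + 1) / 2) \<alpha> + s"
  define \<gamma> where "\<gamma> = Q * inverse E"
  define r where "r = t * inverse D"
  define K where "K l = \<gamma> * r ^ l" for l
  have h: "2 * h = 1"
    by (simp add: h_def numeral_fps_const)
  have E: "E = h * (Q - 1) * L + s"
    by (simp add: E_def lin_def L_def h_def Q_def flip: fps_const_1_eq_1)
  have D: "D = h * (Q + 1) * L + s"
    by (simp add: D_def lin_def L_def h_def Q_def flip: fps_const_1_eq_1)
  have s2: "s\<^sup>2 = (h * (Q + 1) * L)\<^sup>2 - Q * t\<^sup>2"
  proof -
    have "h * (Q + 1) = fps_const ((real q + 1) / 2)"
      by (simp add: h_def Q_def flip: fps_const_1_eq_1)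
    then show ?thesis
      by (simp add: s_def sqrt_Delta Delta_def L_def Q_def t_def power_mult_distrib
          fps_const_power flip: mult.assoc)
  qed
  \<comment> \<open>\<open>D\<close> is a root of the quadratic with root sum
    \<open>(Q + 1) * L\<close> and root product \<open>Q * t\<^sup>2\<close>; the other root has
    \<open>- s\<close> in place of \<open>s\<close>.\<close>
  have D2: "D\<^sup>2 + Q * t\<^sup>2 = (Q + 1) * L * D"
  proof -
    have "D\<^sup>2 + Q * t\<^sup>2 = 2 * h * ((Q + 1) * L * D)"
      using D s2 by algebra
    with h show ?thesis by simp
  qed
  have DE: "D * E + Q * t\<^sup>2 = Q * L * D"
  proof -
    have "D - E = 2 * h * L" using D E by algebra
    with h have "E = D - L" by (simp add: algebra_simps)
    with D2 show ?thesis by algebra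
  qed
  have EI: "E * inverse E = 1"
    using return_denominator_unit[of q \<alpha>] assms(1) by (simp add: E_def s_def)
  have DI: "D * inverse D = 1"
    by (rule inverse_mult_eq_1') (simp add: D_def lin_def s_def sqrt_Delta field_simps)
  have Dr: "D * r = t" using DI by (simp add: r_def mult.left_commute)
  have E\<gamma>: "E * \<gamma> = Q" using EI by (simp add: \<gamma>_def mult.left_commute)
  have nz: "D \<noteq> 0" "E \<noteq> 0" using DI EI by auto
  \<comment> \<open>Multiplication by \<open>D\<^sup>2\<close> turns \<open>r\<close> into
    \<open>t\<close> through \<open>Dr\<close>, and what remains is \<open>D2\<close>.\<close>
  have root: "(Q + 1) * L * r = t * (1 + Q * r\<^sup>2)"
  proof -
    have "D\<^sup>2 * ((Q + 1) * L * r) = (Q + 1) * L * D * (D * r)"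
      by (simp add: power2_eq_square ac_simps)
    also have "\<dots> = t * (D\<^sup>2 + Q * (D * r)\<^sup>2)"
      unfolding Dr D2 by (simp add: ac_simps)
    also have "\<dots> = D\<^sup>2 * (t * (1 + Q * r\<^sup>2))"
      by (simp add: power_mult_distrib algebra_simps)
    finally have "D\<^sup>2 * ((Q + 1) * L * r) = D\<^sup>2 * (t * (1 + Q * r\<^sup>2))" .
    then show ?thesis using nz by simp
  qed
  \<comment> \<open>Multiplication by \<open>D * E\<close> clears both inverses and leaves
    \<open>DE\<close> multiplied by nothing else than the constants from \<open>E\<gamma>\<close>
    and \<open>Dr\<close>.\<close>
  have origin: "L * \<gamma> = 1 + t * (\<gamma> * r)"
  proof -
    have "D * E * (L * \<gamma>) = (E * \<gamma>) * L * D"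
      by (simp add: ac_simps)
    also have "\<dots> = D * E + (E * \<gamma>) * t * (D * r)"
      unfolding E\<gamma> Dr using DE by (simp add: power2_eq_square ac_simps)
    also have "\<dots> = D * E * (1 + t * (\<gamma> * r))"
      by (simp add: algebra_simps)
    finally have "D * E * (L * \<gamma>) = D * E * (1 + t * (\<gamma> * r))" .
    then show ?thesis using nz by simp
  qed
  have K: "pmf (lazy_walk adj \<alpha> u n) v = fps_nth (K (graph_dist adj u v)) n" for u v n
  proof (rule pmf_lazy_walk_eq_fps_nth[OF assms(4)])
    show "(1 - fps_const \<alpha> * fps_X) * K 0 = 1 + fps_const (1 - \<alpha>) * fps_X * K 1"
      using origin by (simp add: K_def L_def t_def)
    fix l
    have "(Q + 1) * L * K (Suc l) = (Q + 1) * L * r * K l"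
      by (simp add: K_def ac_simps)
    also have "\<dots> = t * (K l + Q * K (Suc (Suc l)))"
      unfolding root by (simp add: K_def power2_eq_square algebra_simps)
    finally show "fps_const (real q + 1) * (1 - fps_const \<alpha> * fps_X) * K (Suc l) =
      fps_const (1 - \<alpha>) * fps_X * (K l + fps_const (real q) * K (Suc (Suc l)))"
      by (simp add: Q_def L_def t_def flip: fps_const_1_eq_1)
  qed (use assms in auto)
  have wp: "walk_prob adj \<alpha> l n = fps_nth (K l) n" for l n
    using walk_prob_eqI[of adj \<alpha> n "\<lambda>l. fps_nth (K l) n" l, OF K]
      regular_tree_dist_attained[OF assms(4)] assms(1) by auto
  have walk_gf_nth: "fps_nth (walk_gf adj \<alpha>) l = K l" for l
    by (simp add: walk_gf_def wp fps_eq_iff)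
  have ret: "return_gf adj \<alpha> = \<gamma>"
    by (simp add: return_gf_def wp fps_eq_iff K_def)
  let ?N = "fps_const (lin ((real q + 1) / 2) \<alpha>) + fps_const s"
  let ?B = "fps_const (lin ((real q + 1) / 2) \<alpha>) - fps_const t * fps_X + fps_const s"
  \<comment> \<open>The quotient is compared with \<open>walk_gf\<close> after multiplication by its
    denominator, where coefficients of \<open>x\<close> can be computed.\<close>
  have "?B * (?N / ?B * fps_const \<gamma>) = ?N * fps_const \<gamma>"
    using walk_denominator_unit[of q \<alpha> ?N] by (simp add: s_def t_def flip: mult.assoc)
  also have "\<dots> = ?B * walk_gf adj \<alpha>"
  proof (rule fps_ext)
    fix l
    have B: "?B = fps_const D - fps_const t * fps_X" by (simp add: D_def)
    have N: "?N = fps_const D" by (simp add: D_def)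
    show "fps_nth (?N * fps_const \<gamma>) l = fps_nth (?B * walk_gf adj \<alpha>) l"
      unfolding B N
      \<comment> \<open>In \<open>x\<close>, the denominator is \<open>D * (1 - r x)\<close> because
        \<open>t = D * r\<close>, and it meets a geometric series of ratio \<open>r\<close>:
        everything beyond the constant term \<open>D * \<gamma>\<close> cancels.\<close>
      by (cases l) (simp_all add: left_diff_distrib mult.assoc walk_gf_nth K_def flip: Dr)
  qed
  finally have eq: "?B * (?N / ?B * fps_const \<gamma>) = ?B * walk_gf adj \<alpha>" .
  have "fps_nth ?B 0 \<noteq> 0" using nz by (simp add: D_def)
  then have "?B \<noteq> 0" by (metis fps_zero_nth)
  then have "walk_gf adj \<alpha> = ?N / ?B * fps_const \<gamma>"
    using eq by (metis mult_left_cancel)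
  moreover have "pmf (lazy_walk adj \<alpha> u n) v = walk_prob adj \<alpha> (graph_dist adj u v) n" for u v n
    using K wp by simp
  ultimately show ?thesis
    using ret by (simp add: \<gamma>_def E_def Q_def s_def t_def)
qed

end
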